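(* Let $0<p<1$, $\lambda>0$, and \[ \rho_{p,\lambda}=\bigl(2\lambda(1-p)\bigr)^{1/(2-p)},\qquad \tau_{p,\lambda}=\frac{2-p}{2(1-p)}\rho_{p,\lambda}. \] For every $y\ge\tau_{p,\lambda}$, the larger stationary root satisfies $x_+(y)\ge\rho_{p,\lambda}$, and \[ 1-\frac p2\le\partial_x\Phi_{p,\lambda,y}\bigl(x_+(y)\bigr)<1,\qquad 1<\frac{d x_+(y)}{dy}\le\frac1{1-p/2}. \] Moreover, \[ 0<\varepsilon(y)\le q_pu_\star,\qquad q_p:=p\,2^{1-p}<1. \] Thus, for fixed $p$, both the inverse sensitivity $dx_+/dy$ and the series parameter $\varepsilon(y)$ are uniformly bounded throughout the active proximal domain $y\ge\tau_{p,\lambda}$.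
   Context: For $x>0$ and $y>0$, $\Phi_{p,\lambda,y}(x):=x-y+\lambda p\,x^{p-1}$. Whenever the equation $\Phi_{p,\lambda,y}(x)=0$ has two distinct roots in $(0,\infty)$ (in particular for all $y\ge\tau_{p,\lambda}$), $x_+(y)$ denotes the larger one. Also $\varepsilon(y):=\lambda p\,y^{p-2}$ and $u_\star:=\frac{(1-p)^{1-p}}{(2-p)^{2-p}}$. *)

theory Defs
  imports "HOL-Analysis.Analysis"
begin

definition Phi :: "real \<Rightarrow> real \<Rightarrow> real \<Rightarrow> real \<Rightarrow> real" where
  "Phi p lam y x = x - y + lam * p * x powr (p - 1)"

definition stationary_roots :: "real \<Rightarrow> real \<Rightarrow> real \<Rightarrow> real set" where
  "stationary_roots p lam y = {x. 0 < x \<and> Phi p lam y x = 0}"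

(* The larger of the two roots; meaningful only if card (stationary_roots p lam y) = 2. *)
definition x_plus :: "real \<Rightarrow> real \<Rightarrow> real \<Rightarrow> real" where
  "x_plus p lam y = Max (stationary_roots p lam y)"

definition rho :: "real \<Rightarrow> real \<Rightarrow> real" where
  "rho p lam = (2 * lam * (1 - p)) powr (1 / (2 - p))"

definition tau :: "real \<Rightarrow> real \<Rightarrow> real" where
  "tau p lam = (2 - p) / (2 * (1 - p)) * rho p lam"

definition series_param :: "real \<Rightarrow> real \<Rightarrow> real \<Rightarrow> real" where
  "series_param p lam y = lam * p * y powr (p - 2)"

definition u_star :: "real \<Rightarrow> real" where
  "u_star p = (1 - p) powr (1 - p) / (2 - p) powr (2 - p)"

definition q :: "real \<Rightarrow> real" where
  "q p = p * 2 powr (1 - p)"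

end

theory Submission
  imports Defs
begin

text \<open>
  Write \<open>Phi p lam y x = F x - y\<close> with \<open>F x = x + lam * p * x powr (p - 1)\<close>. The function \<open>F\<close> is
  strictly convex on the positive half-line and blows up at both ends: it falls up to its
  critical point \<open>m\<close>, where \<open>lam * p * (1 - p) * m powr (p - 2) = 1\<close>, and rises afterwards. So every
  level \<open>y > F m\<close> is attained exactly twice, and \<open>x_plus p lam\<close> is the inverse of the rising branch.

  The threshold \<open>tau\<close> is the level \<open>F rho\<close>, and \<open>rho\<close> is the point at which the derivative
  \<open>F' x = 1 - lam * p * (1 - p) * x powr (p - 2)\<close> equals \<open>1 - p / 2\<close>. Since \<open>m < rho\<close> and both \<open>F\<close> and
  \<open>F'\<close> increase beyond \<open>m\<close>, a level \<open>y \<ge> tau\<close> is attained on the rising branch at or beyond \<open>rho\<close>,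
  where \<open>1 - p / 2 \<le> F' < 1\<close>. The bounds on the derivative of \<open>x_plus\<close> are those of its reciprocal.
  As the rising branch extends below \<open>rho\<close>, differentiability is two-sided even at \<open>y = tau\<close>.

  The series parameter decreases in \<open>y\<close>, and its value at \<open>tau\<close> is exactly \<open>q p * u_star p\<close>, which
  is free of \<open>lam\<close>. This is why the bounds are uniform in \<open>lam\<close> as well as in \<open>y\<close>.
\<close>

section \<open>The stationarity function and its critical point\<close>

definition critical_point :: "real \<Rightarrow> real \<Rightarrow> real" where
  "critical_point p lam = (lam * p * (1 - p)) powr (1 / (2 - p))"

lemma Phi_level: "Phi p lam y x = Phi p lam 0 x - y"
  by (simp add: Phi_def)

lemma stationary_roots_eq_level:
  "stationary_roots p lam y = {x. 0 < x \<and> Phi p lam 0 x = y}"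
  using Phi_level[of p lam y] by (auto simp: stationary_roots_def)

lemma Phi_has_derivative:
  assumes "0 < x"
  shows "(Phi p lam y has_real_derivative 1 - lam * p * (1 - p) * x powr (p - 2)) (at x)"
proof -
  have "((\<lambda>x. x - y + lam * p * x powr (p - 1)) has_real_derivative
          1 + lam * p * ((p - 1) * x powr (p - 1 - 1))) (at x)"
    using assms by (auto intro!: derivative_eq_intros)
  then show ?thesis
    by (simp add: Phi_def[abs_def] algebra_simps)
qed

lemma powr_root_inverse:
  fixes a p :: real
  assumes "0 < a" "p < 2"
  shows "(a powr (1 / (2 - p))) powr (p - 2) = 1 / a"
proof -
  have "1 / (2 - p) * (p - 2) = -1"
    using assms by (simp add: field_simps)
  then show ?thesis
    using assms by (simp add: powr_powr powr_minus_divide)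
qed

lemma powr_less_reciprocal_iff:
  fixes a p x :: real
  assumes "0 < a" "p < 2" "0 < x"
  shows "a * x powr (p - 2) < 1 \<longleftrightarrow> a powr (1 / (2 - p)) < x"
    and "1 < a * x powr (p - 2) \<longleftrightarrow> x < a powr (1 / (2 - p))"
proof -
  let ?m = "a powr (1 / (2 - p))"
  have m: "0 < ?m" "a * ?m powr (p - 2) = 1"
    using assms powr_root_inverse[of a p] by auto
  have mono: "u < v \<Longrightarrow> a * v powr (p - 2) < a * u powr (p - 2)" if "0 < u" for u v
    using that assms by (simp add: powr_less_mono2_neg)
  show "a * x powr (p - 2) < 1 \<longleftrightarrow> ?m < x" "1 < a * x powr (p - 2) \<longleftrightarrow> x < ?m"
    using mono[of ?m x] mono[of x ?m] m assms
    by (cases x ?m rule: linorder_cases; force)+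
qed

context
  fixes p lam :: real
  assumes p: "0 < p" "p < 1" and lam: "0 < lam"
begin

lemma critical_point_pos: "0 < critical_point p lam"
  using p lam by (simp add: critical_point_def)

lemma rho_pos: "0 < rho p lam"
  using p lam by (simp add: rho_def)

lemma tau_pos: "0 < tau p lam"
  using p rho_pos by (simp add: tau_def)

lemma critical_point_less_rho: "critical_point p lam < rho p lam"
proof -
  have "lam * (1 - p) * p < lam * (1 - p) * 2"
    using p lam by (intro mult_strict_left_mono) auto
  then show ?thesis
    unfolding critical_point_def rho_def
    using p lam by (intro powr_less_mono2) (auto simp: mult_ac)
qed

lemma Phi_derivative_sign:
  assumes "0 < x"
  shows "0 < 1 - lam * p * (1 - p) * x powr (p - 2) \<longleftrightarrow> critical_point p lam < x"
    and "1 - lam * p * (1 - p) * x powr (p - 2) < 0 \<longleftrightarrow> x < critical_point p lam"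
  using powr_less_reciprocal_iff[of "lam * p * (1 - p)" p x] p lam assms
  by (auto simp: critical_point_def)

lemma Phi_continuous_on: "0 < a \<Longrightarrow> continuous_on {a..b} (Phi p lam y)"
  by (intro continuous_at_imp_continuous_on ballI DERIV_isCont[OF Phi_has_derivative]) auto

lemma Phi_strictly_decreasing:
  assumes "0 < a" "a < b" "b \<le> critical_point p lam"
  shows "Phi p lam y b < Phi p lam y a"
proof (rule DERIV_neg_imp_decreasing_open[OF assms(2) _ Phi_continuous_on[OF assms(1)]])
  fix x assume "a < x" "x < b"
  then show "\<exists>d. (Phi p lam y has_real_derivative d) (at x) \<and> d < 0"
    using assms Phi_has_derivative[of x p lam y] Phi_derivative_sign(2)[of x] by force
qed

lemma Phi_strictly_increasing:
  assumes "critical_point p lam \<le> a" "a < b"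
  shows "Phi p lam y a < Phi p lam y b"
proof -
  have "0 < a" using assms critical_point_pos by linarith
  show ?thesis
  proof (rule DERIV_pos_imp_increasing_open[OF assms(2) _ Phi_continuous_on[OF \<open>0 < a\<close>]])
    fix x assume "a < x" "x < b"
    then show "\<exists>d. (Phi p lam y has_real_derivative d) (at x) \<and> d > 0"
      using assms \<open>0 < a\<close> Phi_has_derivative[of x p lam y] Phi_derivative_sign(1)[of x] by force
  qed
qed

section \<open>The two stationary roots\<close>

text \<open>
  Above its minimum, a level is attained on the rising branch because \<open>Phi p lam 0 y > y\<close>.
\<close>

lemma ex_root_above_critical_point:
  assumes "Phi p lam 0 (critical_point p lam) < y"
  obtains x where "critical_point p lam < x" "Phi p lam 0 x = y"
proof -
  let ?m = "critical_point p lam"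
  note m = critical_point_pos
  have "?m < Phi p lam 0 ?m"
    using m p lam by (simp add: Phi_def)
  then have "?m < y" using assms by linarith
  then have "y \<le> Phi p lam 0 y"
    using m p lam by (simp add: Phi_def)
  then obtain x where "?m \<le> x" "x \<le> y" "Phi p lam 0 x = y"
    using IVT'[of "Phi p lam 0" ?m y y] assms \<open>?m < y\<close> Phi_continuous_on[OF m] by auto
  then show thesis
    using that[of x] assms by (cases "x = ?m") auto
qed

text \<open>
  On the falling branch the singular term \<open>lam * p * x powr (p - 1)\<close> alone already exceeds any
  given level near zero.
\<close>

lemma ex_root_below_critical_point:
  assumes "Phi p lam 0 (critical_point p lam) < y"
  obtains x where "0 < x" "x < critical_point p lam" "Phi p lam 0 x = y"
proof -
  let ?m = "critical_point p lam"
  note m = critical_point_pos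
  have "?m < Phi p lam 0 ?m"
    using m p lam by (simp add: Phi_def)
  then have "0 < y" using assms m by linarith
  \<comment> \<open>At \<open>z\<close> the singular term equals \<open>y\<close>.\<close>
  define z where "z = (y / (lam * p)) powr (1 / (p - 1))"
  define a where "a = min z ?m"
  have "0 < z" using \<open>0 < y\<close> p lam by (simp add: z_def)
  then have a: "0 < a" "a \<le> z" "a \<le> ?m" using m by (auto simp: a_def)
  have "z powr (p - 1) = y / (lam * p)"
    using \<open>0 < y\<close> p lam by (simp add: z_def powr_powr)
  moreover have "z powr (p - 1) \<le> a powr (p - 1)"
    using a p by (intro powr_mono2') auto
  ultimately have "y / (lam * p) \<le> a powr (p - 1)" by simp
  then have "y \<le> lam * p * a powr (p - 1)"
    using p lam by (simp add: pos_divide_le_eq mult_ac)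
  then have "y \<le> Phi p lam 0 a"
    using a by (simp add: Phi_def)
  then obtain x where "a \<le> x" "x \<le> ?m" "Phi p lam 0 x = y"
    using IVT2'[of "Phi p lam 0" ?m y a] assms a Phi_continuous_on[OF a(1)] by auto
  then show thesis
    using that[of x] assms a by (cases "x = ?m") auto
qed

lemma stationary_roots_two_branches:
  assumes x: "critical_point p lam < x"
  obtains w where "w < x" "stationary_roots p lam (Phi p lam 0 x) = {w, x}"
proof -
  let ?m = "critical_point p lam"
  let ?y = "Phi p lam 0 x"
  have "Phi p lam 0 ?m < ?y" using Phi_strictly_increasing x by simp
  then obtain w where w: "0 < w" "w < ?m" "Phi p lam 0 w = ?y"
    by (rule ex_root_below_critical_point)
  have "v = w \<or> v = x" if v: "0 < v" "Phi p lam 0 v = ?y" for v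
  proof (cases "v \<le> ?m")
    case True
    then show ?thesis
      using Phi_strictly_decreasing[of v w 0] Phi_strictly_decreasing[of w v 0] v w
      by (cases v w rule: linorder_cases) auto
  next
    case False
    then show ?thesis
      using Phi_strictly_increasing[of v x 0] Phi_strictly_increasing[of x v 0] v x
      by (cases v x rule: linorder_cases) auto
  qed
  then have "stationary_roots p lam ?y = {w, x}"
    using w x critical_point_pos by (auto simp: stationary_roots_eq_level)
  then show thesis using that[of w] w x by simp
qed

lemma x_plus_inverts_rising_branch:
  assumes "critical_point p lam < x"
  shows "x_plus p lam (Phi p lam 0 x) = x"
  using stationary_roots_two_branches[OF assms] by (metis Max_insert Max_singleton finite.emptyI
      finite.insertI insert_not_empty less_imp_le max.absorb2 x_plus_def)

lemma card_stationary_roots: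
  assumes "critical_point p lam < x"
  shows "card (stationary_roots p lam (Phi p lam 0 x)) = 2"
  using stationary_roots_two_branches[OF assms] by (metis card_2_iff less_irrefl)

lemma x_plus_has_derivative:
  assumes x: "critical_point p lam < x"
  shows "(x_plus p lam has_real_derivative inverse (1 - lam * p * (1 - p) * x powr (p - 2)))
           (at (Phi p lam 0 x))"
proof (rule DERIV_inverse_function)
  let ?m = "critical_point p lam"
  let ?y = "Phi p lam 0 x"
  have "0 < x" using x critical_point_pos by linarith
  then show "(Phi p lam 0 has_real_derivative 1 - lam * p * (1 - p) * x powr (p - 2))
      (at (x_plus p lam ?y))"
    using Phi_has_derivative x_plus_inverts_rising_branch[OF x] by simp
  show "1 - lam * p * (1 - p) * x powr (p - 2) \<noteq> 0"
    using Phi_derivative_sign(1)[OF \<open>0 < x\<close>] x by simp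
  show "Phi p lam 0 ?m < ?y" using Phi_strictly_increasing x by simp
  show "?y < ?y + 1" by simp
  show "Phi p lam 0 (x_plus p lam y) = y" if "Phi p lam 0 ?m < y" "y < ?y + 1" for y
    using ex_root_above_critical_point[OF that(1)] x_plus_inverts_rising_branch by metis
  show "isCont (x_plus p lam) ?y"
  proof (rule isCont_inverse_function[where f = "Phi p lam 0" and x = x and d = "(x - ?m) / 2"])
    \<comment> \<open>This radius keeps the whole neighbourhood of \<open>x\<close> on the rising branch.\<close>
    show "0 < (x - ?m) / 2" using x by simp
    fix z assume "\<bar>z - x\<bar> \<le> (x - ?m) / 2"
    then have "x - z \<le> (x - ?m) / 2"
      using abs_ge_minus_self[of "z - x"] by linarith
    with x have z: "?m < z" by (simp add: field_simps)
    then show "x_plus p lam (Phi p lam 0 z) = z" by (rule x_plus_inverts_rising_branch)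
    show "isCont (Phi p lam 0) z"
      using z critical_point_pos by (intro DERIV_isCont[OF Phi_has_derivative]) linarith
  qed
qed

section \<open>The threshold\<close>

lemma rho_powr: "rho p lam powr (p - 2) = 1 / (2 * lam * (1 - p))"
  unfolding rho_def using p lam by (intro powr_root_inverse) auto

lemma Phi_at_rho: "Phi p lam 0 (rho p lam) = tau p lam"
proof -
  have "rho p lam powr (p - 1) = rho p lam * rho p lam powr (p - 2)"
    using rho_pos powr_mult_base[of "rho p lam" "p - 2"] by simp
  then have "Phi p lam 0 (rho p lam) = rho p lam * (1 + lam * p / (2 * lam * (1 - p)))"
    by (simp add: Phi_def rho_powr algebra_simps)
  also have "1 + lam * p / (2 * lam * (1 - p)) = (2 - p) / (2 * (1 - p))"
    using p lam by (simp add: divide_simps)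
  finally show ?thesis by (simp add: tau_def)
qed

lemma Phi_derivative_beyond_rho:
  assumes "rho p lam \<le> x"
  shows "1 - p / 2 \<le> 1 - lam * p * (1 - p) * x powr (p - 2)"
    and "1 - lam * p * (1 - p) * x powr (p - 2) < 1"
proof -
  have "0 < x" using assms rho_pos by linarith
  have "x powr (p - 2) \<le> 1 / (2 * lam * (1 - p))"
    using powr_mono2'[of "p - 2" "rho p lam" x] p assms rho_pos by (simp add: rho_powr)
  then have "lam * p * (1 - p) * x powr (p - 2) \<le> lam * p * (1 - p) * (1 / (2 * lam * (1 - p)))"
    using p lam by (intro mult_left_mono) auto
  then show "1 - p / 2 \<le> 1 - lam * p * (1 - p) * x powr (p - 2)"
    using p lam by simp
  show "1 - lam * p * (1 - p) * x powr (p - 2) < 1"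
    using p lam \<open>0 < x\<close> by simp
qed

lemma ex_root_beyond_rho:
  assumes "tau p lam \<le> y"
  obtains x where "rho p lam \<le> x" "Phi p lam 0 x = y"
proof -
  have "Phi p lam 0 (critical_point p lam) < y"
    using Phi_strictly_increasing[OF order_refl critical_point_less_rho, of 0] assms
    by (simp add: Phi_at_rho)
  then obtain x where x: "critical_point p lam < x" "Phi p lam 0 x = y"
    by (rule ex_root_above_critical_point)
  then have "\<not> x < rho p lam"
    using Phi_strictly_increasing[of x "rho p lam" 0] assms by (auto simp: Phi_at_rho)
  then show thesis using that[of x] x by simp
qed

section \<open>The series parameter\<close>

text \<open>
  Since \<open>tau\<close> is a multiple of \<open>rho\<close> and \<open>rho powr (p - 2)\<close> is inversely proportional to \<open>lam\<close>, the
  parameter \<open>lam\<close> cancels.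
\<close>

lemma series_param_at_tau: "series_param p lam (tau p lam) = q p * u_star p"
proof -
  have pos: "0 < 1 - p" "0 < 2 - p" using p by auto
  have inv: "z powr (p - 2) = 1 / z powr (2 - p)" for z :: real
    using powr_minus_divide[of z "2 - p"] by simp
  have split: "z powr (2 - p) = z * z powr (1 - p)" if "0 < z" for z :: real
    using that powr_mult_base[of z "1 - p"] by simp
  have "tau p lam powr (p - 2) = ((2 - p) / (2 * (1 - p))) powr (p - 2) * rho p lam powr (p - 2)"
    unfolding tau_def using pos rho_pos by (intro powr_mult)
  also have "\<dots>
      = ((2 - p) / (2 * (1 - p))) powr (p - 2) * (1 / (2 * lam * (1 - p)))"
    by (simp only: rho_powr)
  also have "((2 - p) / (2 * (1 - p))) powr (p - 2)
      = 2 * 2 powr (1 - p) * ((1 - p) * (1 - p) powr (1 - p)) / (2 - p) powr (2 - p)"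
    unfolding inv powr_divide powr_mult
    using pos by (simp add: split[of 2] split[of "1 - p"])
  finally show ?thesis
    using pos lam by (simp add: series_param_def q_def u_star_def)
qed

lemma series_param_bounds:
  assumes "tau p lam \<le> y"
  shows "0 < series_param p lam y" "series_param p lam y \<le> q p * u_star p"
proof -
  have "0 < y" using tau_pos assms by linarith
  then show "0 < series_param p lam y" using p lam by (simp add: series_param_def)
  have "y powr (p - 2) \<le> tau p lam powr (p - 2)"
    using powr_mono2'[of "p - 2" "tau p lam" y] p tau_pos assms by simp
  then have "series_param p lam y \<le> series_param p lam (tau p lam)"
    using p lam by (simp add: series_param_def)
  then show "series_param p lam y \<le> q p * u_star p"
    by (simp add: series_param_at_tau)
qed

end

text \<open>
  Taking logarithms, \<open>ln p \<le> p - 1\<close> and \<open>ln 2 < 1\<close> give \<open>ln (q p) \<le> (p - 1) * (1 - ln 2) < 0\<close>.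
\<close>

lemma q_less_1:
  assumes "0 < p" "p < 1"
  shows "q p < 1"
proof -
  have "(1 - p) * ln 2 < 1 - p"
    using assms ln_2_less_1 by (simp add: mult_less_cancel_left2)
  moreover have "ln p \<le> p - 1" using assms ln_le_minus_one by blast
  moreover have "ln (q p) = ln p + (1 - p) * ln 2"
    using assms by (simp add: q_def ln_mult ln_powr)
  ultimately have "ln (q p) < 0" by linarith
  then show ?thesis
    using assms by (simp add: q_def)
qed

section \<open>Uniform bounds on the active domain\<close>

theorem proposition5p8:
  fixes p :: real
  assumes "0 < p" and "p < 1"
  shows "(\<forall>lam>0. \<forall>y\<ge>tau p lam.
            card (stationary_roots p lam y) = 2
          \<and> rho p lam \<le> x_plus p lam y
          \<and> Phi p lam y differentiable at (x_plus p lam y)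
          \<and> 1 - p / 2 \<le> deriv (Phi p lam y) (x_plus p lam y)
          \<and> deriv (Phi p lam y) (x_plus p lam y) < 1
          \<and> x_plus p lam differentiable at y
          \<and> 1 < deriv (x_plus p lam) y
          \<and> deriv (x_plus p lam) y \<le> 1 / (1 - p / 2)
          \<and> 0 < series_param p lam y
          \<and> series_param p lam y \<le> q p * u_star p)
       \<and> q p < 1
       \<and> (\<exists>C. \<forall>lam>0. \<forall>y\<ge>tau p lam.
            \<bar>deriv (x_plus p lam) y\<bar> \<le> C \<and> \<bar>series_param p lam y\<bar> \<le> C)"
    (is "?bounds \<and> _ \<and> ?uniform")
proof (intro conjI)
  show bounds: ?bounds
  proof (intro allI impI)
    fix lam y :: real
    assume lam: "0 < lam" and y: "tau p lam \<le> y"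
    obtain x where x: "rho p lam \<le> x" "Phi p lam 0 x = y"
      using ex_root_beyond_rho[OF assms lam y] .
    have above: "critical_point p lam < x"
      using critical_point_less_rho[OF assms lam] x by linarith
    have "0 < x" using rho_pos[OF assms lam] x by linarith
    define D where "D = 1 - lam * p * (1 - p) * x powr (p - 2)"
    have D: "1 - p / 2 \<le> D" "D < 1"
      unfolding D_def using Phi_derivative_beyond_rho[OF assms lam x(1)] by auto
    have "x_plus p lam y = x"
      using x_plus_inverts_rising_branch[OF assms lam above] x by simp
    moreover have "(Phi p lam y has_real_derivative D) (at x)"
      unfolding D_def using Phi_has_derivative[OF \<open>0 < x\<close>] .
    moreover have "(x_plus p lam has_real_derivative inverse D) (at y)"
      unfolding D_def using x_plus_has_derivative[OF assms lam above] x by simp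
    moreover have "1 < inverse D" "inverse D \<le> 1 / (1 - p / 2)"
      using D assms by (auto simp: one_less_inverse_iff inverse_eq_divide intro!: divide_left_mono)
    moreover have "card (stationary_roots p lam y) = 2"
      using card_stationary_roots[OF assms lam above] x by simp
    ultimately show "card (stationary_roots p lam y) = 2
          \<and> rho p lam \<le> x_plus p lam y
          \<and> Phi p lam y differentiable at (x_plus p lam y)
          \<and> 1 - p / 2 \<le> deriv (Phi p lam y) (x_plus p lam y)
          \<and> deriv (Phi p lam y) (x_plus p lam y) < 1
          \<and> x_plus p lam differentiable at y
          \<and> 1 < deriv (x_plus p lam) y
          \<and> deriv (x_plus p lam) y \<le> 1 / (1 - p / 2)
          \<and> 0 < series_param p lam y
          \<and> series_param p lam y \<le> q p * u_star p"
      using x D series_param_bounds[OF assms lam y]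
      by (auto simp: DERIV_imp_deriv real_differentiable_def)
  qed
  show "q p < 1" using q_less_1[OF assms] .
  show ?uniform
  proof (intro exI allI impI)
    fix lam y :: real
    assume "0 < lam" "tau p lam \<le> y"
    then show "\<bar>deriv (x_plus p lam) y\<bar> \<le> max (1 / (1 - p / 2)) (q p * u_star p)
        \<and> \<bar>series_param p lam y\<bar> \<le> max (1 / (1 - p / 2)) (q p * u_star p)"
      using bounds by force
  qed
qed

end
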